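(* Let $\lambda>0$ and $y\ge\tau_{1/3,\lambda}$. Set \[ \varepsilon=\tfrac13\lambda\,y^{-5/3},\qquad t=\frac{3125}{108}\,\varepsilon^3 . \] Then, with $S(y)$ the series function for $p=\tfrac13$, \begin{align*} \frac{S(y)}{y}={}&\frac35+\frac25\,{}_4F_3\!\Big(-\tfrac15,\tfrac15,\tfrac25,\tfrac35;\;\tfrac13,\tfrac12,\tfrac23;\,t\Big)\\ &-\varepsilon\,{}_4F_3\!\Big(\tfrac{2}{15},\tfrac{8}{15},\tfrac{11}{15},\tfrac{14}{15};\;\tfrac23,\tfrac56,\tfrac43;\,t\Big)\\ &-\frac23\,\varepsilon^2\,{}_4F_3\!\Big(\tfrac{7}{15},\tfrac{13}{15},\tfrac{16}{15},\tfrac{19}{15};\;\tfrac76,\tfrac43,\tfrac53;\,t\Big). \end{align*} Moreover, at the threshold $y=\tau_{1/3,\lambda}$ one has $t=\tfrac{4}{27}<1$, so for all $y\ge\tau_{1/3,\lambda}$ the argument satisfies $t\in(0,\tfrac4{27}]$ and all three ${}_4F_3$ series converge absolutely.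
   Context: For $0<p<1$ and $\lambda>0$ set $\rho_{p,\lambda}:=(2\lambda(1-p))^{1/(2-p)}$, $\tau_{p,\lambda}:=\frac{2-p}{2(1-p)}\rho_{p,\lambda}$, and for $y\ge\tau_{p,\lambda}$ \[ S(y):=y\left(1-\varepsilon(y)-\sum_{n=2}^{\infty}\frac{\varepsilon(y)^n}{n!}\prod_{j=0}^{n-2}\bigl(n(1-p)+j\bigr)\right),\qquad \varepsilon(y):=\lambda p\,y^{p-2}. \] Equivalently $S(y)=y\bigl(1-\sum_{n\ge1}\frac{\varepsilon(y)^n}{n!}\frac{\Gamma(n(2-p)-1)}{\Gamma(n(1-p))}\bigr)$. Here $p=\tfrac13$. The generalized hypergeometric function is ${}_{\alpha}F_{\beta}(a_1,\ldots,a_\alpha;b_1,\ldots,b_\beta;x)=\sum_{n\ge0}\frac{(a_1)_n\cdots(a_\alpha)_n}{(b_1)_n\cdots(b_\beta)_n}\frac{x^n}{n!}$ with $(a)_n=a(a+1)\cdots(a+n-1)$, $(a)_0=1$. *)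

theory Defs
  imports "HOL-Analysis.Analysis"
begin

definition rho :: "real \<Rightarrow> real \<Rightarrow> real" where
  "rho p lam = (2 * lam * (1 - p)) powr (1 / (2 - p))"

definition tau :: "real \<Rightarrow> real \<Rightarrow> real" where
  "tau p lam = (2 - p) / (2 * (1 - p)) * rho p lam"

definition eps :: "real \<Rightarrow> real \<Rightarrow> real \<Rightarrow> real" where
  "eps p lam y = lam * p * y powr (p - 2)"

(* The term with index n of the series in S. It is used only for n \<ge> 2, so the truncated
   subtraction n - 2 on nat is harmless. *)
definition S_term :: "real \<Rightarrow> real \<Rightarrow> real \<Rightarrow> nat \<Rightarrow> real" where
  "S_term p lam y n =
     eps p lam y ^ n / fact n * (\<Prod>j = 0..n - 2. real n * (1 - p) + real j)"

(* The sum over n \<ge> 2 is indexed by n + 2 with n \<ge> 0. *)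
definition S :: "real \<Rightarrow> real \<Rightarrow> real \<Rightarrow> real" where
  "S p lam y = y * (1 - eps p lam y - (\<Sum>n. S_term p lam y (n + 2)))"

(* The library's formal hypergeometric series fps_hypergeo as bs c has the n-th coefficient
   (\<Prod>a\<in>as. (a)_n) / (\<Prod>b\<in>bs. (b)_n) * c ^ n / n!; taking c = 1 and evaluating at x gives the
   generalized hypergeometric function with parameter lists as and bs. *)
definition hypergeom :: "real list \<Rightarrow> real list \<Rightarrow> real \<Rightarrow> real" where
  "hypergeom as bs x = eval_fps (fps_hypergeo as bs 1) x"

definition hypergeom_abs_conv :: "real list \<Rightarrow> real list \<Rightarrow> real \<Rightarrow> bool" where
  "hypergeom_abs_conv as bs x \<longleftrightarrow>
     summable (\<lambda>n. \<bar>fps_nth (fps_hypergeo as bs 1) n * x ^ n\<bar>)"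

end

theory Submission
  imports Defs
begin

text \<open>
  For \<open>n \<ge> 1\<close> the coefficient of \<open>\<epsilon> ^ n\<close> in \<open>1 - S(y)/y\<close> is
  \<open>(2n/3)\<^sub>n\<^sub>-\<^sub>1 / n!\<close>, and the elementary identity
  \<open>(x)\<^sub>n\<^sub>-\<^sub>1 (x + n) (x + n - 1) = x (x + 1)\<^sub>n\<close> at \<open>x = 2n/3\<close> brings it into the form
  \<open>c n = 2/5 \<cdot> (2n/3 + 1)\<^sub>n / ((5n/3 - 1) n!)\<close>. This form makes sense at \<open>n = 0\<close> too,
  where it gives \<open>-2/5\<close>. Therefore \<open>S(y)/y = 1 - (2/5 + \<Sum> c n \<epsilon> ^ n)\<close>, summed over all \<open>n \<ge> 0\<close>,
  which is the origin of the additive constant \<open>3/5\<close>.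

  Both \<open>2n/3\<close> and \<open>5n/3\<close> grow by an integer when \<open>n\<close> grows by three, so \<open>c (n + 3) / c n\<close> is a
  rational function of \<open>n\<close> (\<open>series_coeff_plus_3\<close>). After cancellation four linear factors
  remain on either side, with leading quotient \<open>3125/108\<close>; substituting \<open>n = 3m + r\<close> turns it into
  the ratio of consecutive terms of a \<open>\<^sub>4F\<^sub>3\<close> in \<open>t = 3125/108 \<epsilon>\<^sup>3\<close>. A sequence is determined by
  its initial value and its ratios (\<open>hypergeo_nth_unique\<close>), so the three residue classes modulo
  \<open>3\<close> give the three hypergeometric functions, with prefactors \<open>c r \<epsilon> ^ r\<close> for \<open>r = 0, 1, 2\<close>,
  that is \<open>-2/5\<close>, \<open>\<epsilon>\<close> and \<open>2/3 \<epsilon>\<^sup>2\<close>.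

  Convergence: as there is one upper parameter more than lower ones, the ratio of consecutive
  coefficients tends to \<open>1\<close>, and \<open>0 < t \<le> 4/27\<close> because \<open>t\<close> decreases in \<open>y\<close>. Convergence of the
  three subseries in turn gives convergence of the series defining \<open>S\<close>.
\<close>

section \<open>Hypergeometric series inside the unit disc\<close>

lemma hypergeo_nth_Suc:
  fixes as bs :: "real list"
  shows "fps_nth (fps_hypergeo as bs 1) (Suc n) =
    fps_nth (fps_hypergeo as bs 1) n *
      ((\<Prod>a\<leftarrow>as. a + real n) / ((\<Prod>b\<leftarrow>bs. b + real n) * real (Suc n)))"
proof -
  have foldl_eq: "foldl (\<lambda>r a. r * (a + real n)) c xs = c * (\<Prod>a\<leftarrow>xs. a + real n)"
    for c :: real and xs
    by (induction xs arbitrary: c) (simp_all add: algebra_simps)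
  show ?thesis
    by (simp add: fps_hypergeo_rec foldl_eq mult_ac del: fps_hypergeo_nth of_nat_Suc)
qed

text \<open>A geometric rescaling of the argument only changes the ratio of consecutive terms by a
  constant, which is the factor \<open>K\<close> here.\<close>

lemma hypergeo_nth_unique:
  fixes f :: "nat \<Rightarrow> real"
  assumes "\<And>m. f (Suc m) =
    f m * (K * ((\<Prod>a\<leftarrow>as. a + real m) / ((\<Prod>b\<leftarrow>bs. b + real m) * real (Suc m))))"
  shows "f m = f 0 * (fps_nth (fps_hypergeo as bs 1) m * K ^ m)"
proof (induction m)
  case 0
  then show ?case by (simp only: fps_hypergeo_0 power_0 mult_1_right)
next
  case (Suc m)
  then show ?case
    by (simp add: assms hypergeo_nth_Suc mult_ac del: fps_hypergeo_nth of_nat_Suc)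
qed

lemma tendsto_prod_list_shift_over_power:
  fixes xs :: "real list"
  shows "(\<lambda>n. (\<Prod>x\<leftarrow>xs. x + real n) / real (Suc n) ^ length xs) \<longlonglongrightarrow> 1"
proof (induction xs)
  case Nil
  then show ?case by simp
next
  case (Cons x xs)
  have "(\<lambda>n. 1 + (x - 1) / real (Suc n)) \<longlonglongrightarrow> 1 + 0"
    by (intro tendsto_add tendsto_const LIMSEQ_Suc[OF lim_const_over_n])
  moreover have "1 + (x - 1) / real (Suc n) = (x + real n) / real (Suc n)" for n
    by (simp add: field_simps)
  ultimately have "(\<lambda>n. (x + real n) / real (Suc n)) \<longlonglongrightarrow> 1"
    by simp
  from tendsto_mult[OF this Cons.IH] show ?case
    by simp
qed

text \<open>This is the ratio test: the balanced parameter count makes the ratio of consecutive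
  coefficients tend to \<open>1\<close>. If a lower parameter is a nonpositive integer, the coefficients
  vanish from some index on, since division by zero yields zero.\<close>

lemma hypergeom_abs_conv_if_abs_less_1:
  assumes len: "length as = Suc (length bs)" and x: "\<bar>x\<bar> < 1"
  shows "hypergeom_abs_conv as bs x"
proof -
  define R where
    "R n = (\<Prod>a\<leftarrow>as. a + real n) / ((\<Prod>b\<leftarrow>bs. b + real n) * real (Suc n))" for n
  have "(\<lambda>n. ((\<Prod>a\<leftarrow>as. a + real n) / real (Suc n) ^ length as) /
              ((\<Prod>b\<leftarrow>bs. b + real n) / real (Suc n) ^ length bs)) \<longlonglongrightarrow> 1 / 1"
    by (intro tendsto_divide tendsto_prod_list_shift_over_power) simp
  moreover have "((\<Prod>a\<leftarrow>as. a + real n) / real (Suc n) ^ length as) /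
              ((\<Prod>b\<leftarrow>bs. b + real n) / real (Suc n) ^ length bs) = R n" for n
    by (simp add: R_def len del: of_nat_Suc)
  ultimately have "R \<longlonglongrightarrow> 1" by simp
  then have lim: "(\<lambda>n. \<bar>R n * x\<bar>) \<longlonglongrightarrow> \<bar>1 * x\<bar>"
    by (intro tendsto_intros)
  obtain c where c: "\<bar>x\<bar> < c" "c < 1"
    using x dense by blast
  from lim c have "eventually (\<lambda>n. \<bar>R n * x\<bar> < c) sequentially"
    by (intro order_tendstoD(2)[OF lim]) simp
  then obtain N where N: "\<And>n. n \<ge> N \<Longrightarrow> \<bar>R n * x\<bar> < c"
    by (auto simp: eventually_sequentially)
  define u where "u n = \<bar>fps_nth (fps_hypergeo as bs 1) n * x ^ n\<bar>" for n
  have "summable u"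
  proof (rule summable_ratio_test[OF \<open>c < 1\<close>])
    fix n assume "n \<ge> N"
    have "u (Suc n) = \<bar>R n * x\<bar> * u n"
      by (simp add: u_def hypergeo_nth_Suc R_def abs_mult mult_ac
               del: fps_hypergeo_nth of_nat_Suc)
    also have "\<dots> \<le> c * u n"
      using N[OF \<open>n \<ge> N\<close>] by (intro mult_right_mono) (auto simp: u_def)
    finally show "norm (u (Suc n)) \<le> c * norm (u n)"
      by (simp add: u_def)
  qed
  then show ?thesis
    unfolding hypergeom_abs_conv_def u_def .
qed

lemma sums_hypergeom:
  assumes "length as = Suc (length bs)" "\<bar>x\<bar> < 1"
  shows "(\<lambda>n. fps_nth (fps_hypergeo as bs 1) n * x ^ n) sums hypergeom as bs x"
proof -
  have "summable (\<lambda>n. fps_nth (fps_hypergeo as bs 1) n * x ^ n)"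
    using hypergeom_abs_conv_if_abs_less_1[OF assms]
    unfolding hypergeom_abs_conv_def by (rule summable_rabs_cancel)
  then show ?thesis
    unfolding hypergeom_def eval_fps_def by (rule summable_sums)
qed

section \<open>Sums over residue classes\<close>

lemma sums_three_residue_classes:
  fixes f :: "nat \<Rightarrow> real"
  assumes "(\<lambda>m. f (3 * m)) sums s0" "(\<lambda>m. f (3 * m + 1)) sums s1"
    "(\<lambda>m. f (3 * m + 2)) sums s2"
  shows "f sums (s0 + s1 + s2)"
proof -
  have residue: "(\<lambda>n. if n mod 3 = r then f n else 0) sums s"
    if "(\<lambda>m. f (3 * m + r)) sums s" "r < 3" for r s
  proof -
    define g where "g = (\<lambda>n. if n mod 3 = r then f n else 0)"
    have "(\<lambda>m. g (3 * m + r)) sums s \<longleftrightarrow> g sums s"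
    proof (rule sums_mono_reindex)
      show "strict_mono (\<lambda>m. 3 * m + r)" by (simp add: strict_mono_def)
      fix n assume "n \<notin> range (\<lambda>m. 3 * m + r)"
      then have "n \<noteq> 3 * (n div 3) + r" by blast
      then show "g n = 0" by (simp add: g_def) (metis mult_div_mod_eq)
    qed
    with that(1) have "g sums s"
      by (simp add: g_def that(2))
    then show ?thesis by (simp only: g_def)
  qed
  have "(\<lambda>n. (if n mod 3 = 0 then f n else 0) + (if n mod 3 = 1 then f n else 0)
          + (if n mod 3 = 2 then f n else 0)) sums (s0 + s1 + s2)"
    using assms by (intro sums_add residue) simp_all
  moreover have "(if n mod 3 = 0 then f n else 0) + (if n mod 3 = 1 then f n else 0)
          + (if n mod 3 = 2 then f n else 0) = f n" for n
  proof -
    have "n mod 3 = 0 \<or> n mod 3 = 1 \<or> n mod 3 = 2" by linarith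
    then show ?thesis by auto
  qed
  ultimately show ?thesis by simp
qed

section \<open>The coefficients for p = 1/3\<close>

text \<open>For \<open>n \<ge> 1\<close> this is \<open>\<Gamma>(5n/3 - 1) / (\<Gamma>(2n/3) n!)\<close>; at \<open>n = 0\<close>, where both Gamma
  functions have a pole, it is the limit of that quotient as \<open>n\<close> tends to \<open>0\<close>.\<close>

definition series_coeff :: "nat \<Rightarrow> real" where
  "series_coeff n =
     2/5 * pochhammer (2 * real n / 3 + 1) n / ((5 * real n / 3 - 1) * fact n)"

lemma series_coeff_0: "series_coeff 0 = -2/5"
  and series_coeff_1: "series_coeff 1 = 1"
  and series_coeff_2: "series_coeff 2 = 2/3"
  by (simp_all add: series_coeff_def numeral_2_eq_2 pochhammer_Suc)

lemma pochhammer_drop_last_two: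
  fixes x :: real
  shows "pochhammer x (Suc n) * (x + real n + 2) * (x + real n + 1) =
    x * pochhammer (x + 1) (n + 2)"
proof -
  have "pochhammer x (Suc n) * (x + real n + 2) * (x + real n + 1) = pochhammer x (Suc (n + 2))"
    by (simp add: pochhammer_Suc algebra_simps)
  also have "\<dots> = x * pochhammer (x + 1) (n + 2)"
    by (rule pochhammer_rec)
  finally show ?thesis .
qed

lemma S_term_eq_series_coeff:
  "S_term (1/3) lam y (n + 2) = series_coeff (n + 2) * eps (1/3) lam y ^ (n + 2)"
proof -
  define x where "x = 2 * real (n + 2) / 3"
  have pos: "x > 0" "x + real n + 2 > 0" "x + real n + 1 > 0"
    by (simp_all add: x_def add_pos_nonneg)
  have "(\<Prod>j = 0..n + 2 - 2. real (n + 2) * (1 - 1/3) + real j) = pochhammer x (Suc n)"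
    by (simp add: pochhammer_prod x_def atLeastLessThanSuc_atLeastAtMost atLeast0AtMost
        lessThan_Suc_atMost mult_ac)
  also have "\<dots> = x * pochhammer (x + 1) (n + 2) / ((x + real n + 2) * (x + real n + 1))"
    using pochhammer_drop_last_two[of x n] pos
    by (intro nonzero_eq_divide_eq[THEN iffD2]) (simp_all add: mult_ac)
  also have "\<dots> = (x / (x + real n + 2)) * (pochhammer (x + 1) (n + 2) / (x + real n + 1))"
    by simp
  also have "x / (x + real n + 2) = 2/5"
    by (simp add: x_def field_simps)
  also have "x + real n + 1 = 5 * real (n + 2) / 3 - 1"
    by (simp add: x_def field_simps)
  finally show ?thesis
    by (simp add: S_term_def series_coeff_def x_def mult_ac)
qed

text \<open>Going from \<open>n\<close> to \<open>n + 3\<close> moves the block of factors in the numerator from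
  \<open>2n/3 + 1, \<dots>, 5n/3\<close> to \<open>2n/3 + 3, \<dots>, 5n/3 + 5\<close>. The factor \<open>5n/3 + 4\<close> cancels against
  \<open>5(n + 3)/3 - 1\<close>, while \<open>5n/3 + 5\<close> and \<open>2n/3 + 2\<close> are both proportional to
  \<open>n + 3\<close> and leave the quotient \<open>5/2\<close>.
  The right-hand side is scaled to the variable \<open>n/3\<close>, in which the
  roots are the hypergeometric parameters.\<close>

lemma series_coeff_plus_3:
  fixes n :: nat
  defines "z \<equiv> real n / 3"
  shows "series_coeff (n + 3) = series_coeff n * (3125/108 *
    ((z - 1/5) * (z + 1/5) * (z + 2/5) * (z + 3/5) /
     ((z + 1/3) * (z + 1/2) * (z + 2/3) * (z + 1))))"
proof -
  have n: "real n = 3 * z" by (simp add: z_def)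
  have z0: "z \<ge> 0" by (simp add: z_def)
  have "5 * real n \<noteq> 3"
  proof
    assume "5 * real n = 3"
    then have "real (5 * n) = real 3" by simp
    then have "5 * n = 3" by (simp only: of_nat_eq_iff)
    then show False by presburger
  qed
  then have z1: "5 * z - 1 \<noteq> 0" by (simp add: n)
  define P where "P = pochhammer (2 * z + 1) n"
  define Q where "Q = pochhammer (2 * z + 3) (n + 3)"
  have "pochhammer (2 * z + 1) (n + 5) = pochhammer (2 * z + 1) (2 + (n + 3))"
    by (simp add: add_ac)
  also have "\<dots> = (2 * z + 1) * (2 * z + 2) * Q"
    unfolding pochhammer_product' Q_def by (simp add: numeral_2_eq_2 pochhammer_Suc algebra_simps)
  finally have "(2 * z + 1) * (2 * z + 2) * Q = pochhammer (2 * z + 1) (n + 5)" ..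
  also have "\<dots> = P *
      ((5 * z + 1) * (5 * z + 2) * (5 * z + 3) * (5 * z + 4) * (5 * z + 5))"
    unfolding pochhammer_product' P_def
    by (simp add: n eval_nat_numeral pochhammer_Suc add_ac)
  finally have Q: "Q = P *
      ((5 * z + 1) * (5 * z + 2) * (5 * z + 3) * (5 * z + 4) * (5 * z + 5)) /
      ((2 * z + 1) * (2 * z + 2))"
    using z0 by (intro nonzero_eq_divide_eq[THEN iffD2]) (simp_all add: mult_ac)
  have fact3: "fact (n + 3) = (3 * z + 3) * (3 * z + 2) * (3 * z + 1) * (fact n :: real)"
    by (simp add: n eval_nat_numeral algebra_simps)
  have "series_coeff (n + 3) =
      2/5 * Q / ((5 * z + 4) * ((3 * z + 3) * (3 * z + 2) * (3 * z + 1) * fact n))"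
  proof -
    have shift: "2 * real (n + 3) / 3 + 1 = 2 * z + 3" "5 * real (n + 3) / 3 - 1 = 5 * z + 4"
      by (simp_all add: n field_simps)
    show ?thesis
      unfolding series_coeff_def shift fact3 Q_def by (simp add: mult_ac)
  qed
  also have "\<dots> = 2/5 * P / ((5 * z - 1) * fact n) *
      ((5 * z - 1) * (5 * z + 1) * (5 * z + 2) * (5 * z + 3) * (5 * z + 5) /
       ((2 * z + 1) * (2 * z + 2) * (3 * z + 3) * (3 * z + 2) * (3 * z + 1)))"
    unfolding Q using z0 z1 by (simp add: divide_simps)
  also have "(5 * z - 1) * (5 * z + 1) * (5 * z + 2) * (5 * z + 3) * (5 * z + 5) =
      3125 * (z + 1) * ((z - 1/5) * (z + 1/5) * (z + 2/5) * (z + 3/5))"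
    by (simp add: field_simps)
  also have "(2 * z + 1) * (2 * z + 2) * (3 * z + 3) * (3 * z + 2) * (3 * z + 1) =
      108 * (z + 1) * ((z + 1/3) * (z + 1/2) * (z + 2/3) * (z + 1))"
    by (simp add: field_simps)
  also have "3125 * (z + 1) * ((z - 1/5) * (z + 1/5) * (z + 2/5) * (z + 3/5)) /
      (108 * (z + 1) * ((z + 1/3) * (z + 1/2) * (z + 2/3) * (z + 1))) = 3125/108 *
    ((z - 1/5) * (z + 1/5) * (z + 2/5) * (z + 3/5) /
     ((z + 1/3) * (z + 1/2) * (z + 2/3) * (z + 1)))"
  proof -
    have cancel: "3125 * w * N / (108 * w * D) = 3125/108 * (N / D)" if "w \<noteq> 0" for w N D :: real
      using that by simp
    show ?thesis
      by (rule cancel) (use z0 in simp)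
  qed
  also have "2/5 * P / ((5 * z - 1) * fact n) = series_coeff n"
    by (simp add: series_coeff_def P_def n)
  finally show ?thesis .
qed

text \<open>Substituting \<open>n = 3m + r\<close> shifts every parameter by \<open>r/3\<close>; the lower parameter that becomes
  \<open>1\<close> supplies the factorial of the hypergeometric series.\<close>

lemma series_coeff_residue_0:
  "series_coeff (3 * m) = -2/5 *
    (fps_nth (fps_hypergeo [-1/5, 1/5, 2/5, 3/5] [1/3, 1/2, 2/3] 1) m * (3125/108) ^ m)"
proof -
  have "series_coeff (3 * Suc m) = series_coeff (3 * m) * (3125/108 *
      ((\<Prod>a\<leftarrow>[-1/5, 1/5, 2/5, 3/5]. a + real m) /
       ((\<Prod>b\<leftarrow>[1/3, 1/2, 2/3]. b + real m) * real (Suc m))))" for m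
    using series_coeff_plus_3[of "3 * m"] by (simp add: add_ac mult_ac)
  from hypergeo_nth_unique[of "\<lambda>m. series_coeff (3 * m)", OF this] show ?thesis
    by (simp add: series_coeff_0 del: fps_hypergeo_nth)
qed

lemma series_coeff_residue_1:
  "series_coeff (3 * m + 1) =
    fps_nth (fps_hypergeo [2/15, 8/15, 11/15, 14/15] [2/3, 5/6, 4/3] 1) m * (3125/108) ^ m"
proof -
  have "series_coeff (3 * Suc m + 1) = series_coeff (3 * m + 1) * (3125/108 *
      ((\<Prod>a\<leftarrow>[2/15, 8/15, 11/15, 14/15]. a + real m) /
       ((\<Prod>b\<leftarrow>[2/3, 5/6, 4/3]. b + real m) * real (Suc m))))" for m
  proof -
    have z: "real (3 * m + 1) / 3 = real m + 1/3" by simp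
    show ?thesis
      using series_coeff_plus_3[of "3 * m + 1"] unfolding z
      by (simp add: add_ac mult_ac)
  qed
  from hypergeo_nth_unique[of "\<lambda>m. series_coeff (3 * m + 1)", OF this] show ?thesis
    using series_coeff_1 by (simp del: fps_hypergeo_nth)
qed

lemma series_coeff_residue_2:
  "series_coeff (3 * m + 2) = 2/3 *
    (fps_nth (fps_hypergeo [7/15, 13/15, 16/15, 19/15] [7/6, 4/3, 5/3] 1) m * (3125/108) ^ m)"
proof -
  have "series_coeff (3 * Suc m + 2) = series_coeff (3 * m + 2) * (3125/108 *
      ((\<Prod>a\<leftarrow>[7/15, 13/15, 16/15, 19/15]. a + real m) /
       ((\<Prod>b\<leftarrow>[7/6, 4/3, 5/3]. b + real m) * real (Suc m))))" for m
  proof -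
    have z: "real (3 * m + 2) / 3 = real m + 2/3" by simp
    show ?thesis
      using series_coeff_plus_3[of "3 * m + 2"] unfolding z
      by (simp add: add_ac mult_ac)
  qed
  from hypergeo_nth_unique[of "\<lambda>m. series_coeff (3 * m + 2)", OF this] show ?thesis
    by (simp add: series_coeff_2[unfolded numeral_2_eq_2] del: fps_hypergeo_nth)
qed

lemma series_coeff_sums:
  fixes \<epsilon> :: real
  defines "x \<equiv> 3125/108 * \<epsilon> ^ 3"
  assumes x: "\<bar>x\<bar> < 1"
  shows "(\<lambda>n. series_coeff n * \<epsilon> ^ n) sums
    (-2/5 * hypergeom [-1/5, 1/5, 2/5, 3/5] [1/3, 1/2, 2/3] x
     + \<epsilon> * hypergeom [2/15, 8/15, 11/15, 14/15] [2/3, 5/6, 4/3] x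
     + 2/3 * \<epsilon> ^ 2 * hypergeom [7/15, 13/15, 16/15, 19/15] [7/6, 4/3, 5/3] x)"
proof -
  have pow: "x ^ m = (3125/108) ^ m * \<epsilon> ^ (3 * m)" for m
    by (simp only: x_def power_mult_distrib power_mult)
  note F = sums_mult[OF sums_hypergeom[OF _ x]]
  show ?thesis
  proof (rule sums_three_residue_classes)
    show "(\<lambda>m. series_coeff (3 * m) * \<epsilon> ^ (3 * m)) sums
        (-2/5 * hypergeom [-1/5, 1/5, 2/5, 3/5] [1/3, 1/2, 2/3] x)"
      using F[of "[-1/5, 1/5, 2/5, 3/5]" "[1/3, 1/2, 2/3]" "-2/5"]
      unfolding series_coeff_residue_0 by (simp add: pow mult_ac del: fps_hypergeo_nth)
    show "(\<lambda>m. series_coeff (3 * m + 1) * \<epsilon> ^ (3 * m + 1)) sums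
        (\<epsilon> * hypergeom [2/15, 8/15, 11/15, 14/15] [2/3, 5/6, 4/3] x)"
      using F[of "[2/15, 8/15, 11/15, 14/15]" "[2/3, 5/6, 4/3]" \<epsilon>]
      unfolding series_coeff_residue_1 by (simp add: pow mult_ac del: fps_hypergeo_nth)
    show "(\<lambda>m. series_coeff (3 * m + 2) * \<epsilon> ^ (3 * m + 2)) sums
        (2/3 * \<epsilon> ^ 2 * hypergeom [7/15, 13/15, 16/15, 19/15] [7/6, 4/3, 5/3] x)"
      using F[of "[7/15, 13/15, 16/15, 19/15]" "[7/6, 4/3, 5/3]" "2/3 * \<epsilon> ^ 2"]
      unfolding series_coeff_residue_2
      by (simp add: pow power_add power2_eq_square mult_ac del: fps_hypergeo_nth)
  qed
qed

section \<open>The threshold\<close>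

lemma tau_one_third_pos: "lam > 0 \<Longrightarrow> tau (1/3) lam > 0"
  by (simp add: tau_def rho_def)

text \<open>Since \<open>\<tau> = 5/4 \<rho>\<close> and \<open>\<rho> ^ (-5/3) = 3/(4 \<lambda>)\<close>, one finds
  \<open>\<epsilon> = (5/4) ^ (-5/3) / 4\<close>, independently of \<open>\<lambda>\<close>.\<close>

lemma eps_cubed_at_tau_one_third:
  assumes "lam > 0"
  shows "(1/3 * lam * tau (1/3) lam powr (-5/3)) ^ 3 = 16/3125"
proof -
  have rho: "rho (1/3) lam powr (-5/3) = 3 / (4 * lam)"
  proof -
    have "rho (1/3) lam powr (-5/3) = (4 * lam / 3) powr (-1)"
      by (simp add: rho_def powr_powr mult_ac)
    also have "\<dots> = inverse (4 * lam / 3)"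
      using assms by (simp add: powr_minus)
    finally show ?thesis by simp
  qed
  have "((5/4::real) powr (-5/3)) ^ 3 = (5/4) powr (-5)"
    by (simp add: powr_power)
  also have "\<dots> = inverse ((5/4) ^ 5)"
    by (simp add: powr_minus)
  finally have cube: "((5/4::real) powr (-5/3)) ^ 3 = 1024/3125"
    by (simp add: power_divide)
  have tau: "tau (1/3) lam = 5/4 * rho (1/3) lam"
    by (simp add: tau_def)
  have "1/3 * lam * tau (1/3) lam powr (-5/3) =
      1/3 * lam * ((5/4) powr (-5/3) * (3 / (4 * lam)))"
    unfolding tau by (simp only: powr_mult rho)
  also have "\<dots> = 1/4 * (5/4) powr (-5/3)"
    using assms by simp
  finally have "(1/3 * lam * tau (1/3) lam powr (-5/3)) ^ 3 = (1/4) ^ 3 * (1024/3125)"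
    by (simp only: power_mult_distrib cube)
  then show ?thesis
    by (simp add: power_divide)
qed

theorem theorem4p5:
  fixes lam :: real and e t :: "real \<Rightarrow> real"
  assumes "lam > 0"
  defines "e \<equiv> \<lambda>y. 1/3 * lam * y powr (-5/3)"
      and "t \<equiv> \<lambda>y. 3125/108 * e y ^ 3"
  shows "(\<forall>y \<ge> tau (1/3) lam.
            summable (\<lambda>n. S_term (1/3) lam y (n + 2)) \<and>
            S (1/3) lam y / y =
              3/5 + 2/5 * hypergeom [-1/5, 1/5, 2/5, 3/5] [1/3, 1/2, 2/3] (t y)
              - e y * hypergeom [2/15, 8/15, 11/15, 14/15] [2/3, 5/6, 4/3] (t y)
              - 2/3 * e y ^ 2 * hypergeom [7/15, 13/15, 16/15, 19/15] [7/6, 4/3, 5/3] (t y))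
       \<and> t (tau (1/3) lam) = 4/27 \<and> (4/27 :: real) < 1
       \<and> (\<forall>y \<ge> tau (1/3) lam.
            t y \<in> {0<..4/27} \<and>
            hypergeom_abs_conv [-1/5, 1/5, 2/5, 3/5] [1/3, 1/2, 2/3] (t y) \<and>
            hypergeom_abs_conv [2/15, 8/15, 11/15, 14/15] [2/3, 5/6, 4/3] (t y) \<and>
            hypergeom_abs_conv [7/15, 13/15, 16/15, 19/15] [7/6, 4/3, 5/3] (t y))"
proof -
  note tau_pos = tau_one_third_pos[OF \<open>lam > 0\<close>]
  have t_tau: "t (tau (1/3) lam) = 4/27"
    unfolding t_def e_def eps_cubed_at_tau_one_third[OF \<open>lam > 0\<close>] by simp
  have t_range: "t y \<in> {0<..4/27}" if y: "y \<ge> tau (1/3) lam" for y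
  proof -
    have e_pos: "e y > 0"
      using \<open>lam > 0\<close> tau_pos y by (simp add: e_def)
    have "e y \<le> e (tau (1/3) lam)"
      unfolding e_def using \<open>lam > 0\<close> tau_pos y
      by (intro mult_left_mono powr_mono2') auto
    then have "t y \<le> t (tau (1/3) lam)"
      unfolding t_def using e_pos by (intro mult_left_mono power_mono) auto
    moreover have "t y > 0" using e_pos by (simp add: t_def)
    ultimately show ?thesis using t_tau by simp
  qed
  then have t_abs: "\<bar>t y\<bar> < 1" if "y \<ge> tau (1/3) lam" for y
    using that by fastforce
  have S_eq: "summable (\<lambda>n. S_term (1/3) lam y (n + 2)) \<and>
            S (1/3) lam y / y =
              3/5 + 2/5 * hypergeom [-1/5, 1/5, 2/5, 3/5] [1/3, 1/2, 2/3] (t y)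
              - e y * hypergeom [2/15, 8/15, 11/15, 14/15] [2/3, 5/6, 4/3] (t y)
              - 2/3 * e y ^ 2 * hypergeom [7/15, 13/15, 16/15, 19/15] [7/6, 4/3, 5/3] (t y)"
    (is "_ \<and> _ = 3/5 + 2/5 * ?F0 - ?F1 - ?F2")
    if y: "y \<ge> tau (1/3) lam" for y
  proof -
    have eps: "eps (1/3) lam y = e y" by (simp add: eps_def e_def)
    have "(\<lambda>n. series_coeff n * e y ^ n) sums (-2/5 * ?F0 + ?F1 + ?F2)"
      unfolding t_def by (rule series_coeff_sums) (use t_abs[OF y] in \<open>simp add: t_def\<close>)
    then have "(\<lambda>n. series_coeff (n + 2) * e y ^ (n + 2)) sums
        (-2/5 * ?F0 + ?F1 + ?F2 - (\<Sum>n<2. series_coeff n * e y ^ n))"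
      by (rule sums_split_initial_segment)
    moreover have "(\<Sum>n<2. series_coeff n * e y ^ n) = -2/5 + e y"
      using series_coeff_0 series_coeff_1 by (simp add: numeral_2_eq_2)
    ultimately have sums: "(\<lambda>n. S_term (1/3) lam y (n + 2)) sums
        (-2/5 * ?F0 + ?F1 + ?F2 - (-2/5 + e y))"
      unfolding S_term_eq_series_coeff eps by simp
    have "S (1/3) lam y / y = 1 - e y - (\<Sum>n. S_term (1/3) lam y (n + 2))"
      using tau_pos y by (simp add: S_def eps)
    then show ?thesis
      using sums_unique[OF sums] sums_summable[OF sums] by simp
  qed
  show ?thesis
    using S_eq t_tau t_range t_abs by (auto intro!: hypergeom_abs_conv_if_abs_less_1)
qed

end
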